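(* For every even positive integer $n$, there are at most $2^{\left\lceil \frac{n}{24}\right\rceil}$ multi-symmetric Steinhaus matrices of size $n$ whose associated Steinhaus graphs are regular modulo $4$.
   Context: A Steinhaus matrix of size $n\geq1$ is a matrix $M=(a_{i,j})_{1\leq i,j\leq n}$ with entries in $\mathbb{F}_2=\{0,1\}$ such that $a_{i,i}=0$ for all $i$, $a_{i,j}=a_{i-1,j-1}+a_{i-1,j}$ (addition in $\mathbb{F}_2$) for all $2\leq i<j\leq n$, and $a_{i,j}=a_{j,i}$ for all $i,j$. The associated Steinhaus graph is the simple graph on vertices $V_1,\ldots,V_n$ with adjacency matrix $M$. A graph is regular modulo $4$ if all its vertex degrees are congruent modulo $4$. A square matrix $(a_{i,j})$ of size $n$ is doubly-symmetric if $a_{i,j}=a_{j,i}=a_{n-j+1,n-i+1}$ for all $i,j$; it is multi-symmetric if it is doubly-symmetric and $a_{i,j}=a_{i,n-j+i+1}$ for all $1\leq i<j\leq n$. *)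

theory Defs
  imports
    "Jordan_Normal_Form.Matrix"
    "HOL-Library.Z2"
    "HOL-Number_Theory.Cong"
begin

(* Matrices of the library are indexed from 0; entry gives the usual indexing from 1.
   The field with two elements is the type bit. *)
definition entry :: "'a mat \<Rightarrow> nat \<Rightarrow> nat \<Rightarrow> 'a" where
  "entry M i j = M $$ (i - 1, j - 1)"

definition steinhaus_matrix :: "nat \<Rightarrow> bit mat \<Rightarrow> bool" where
  "steinhaus_matrix n M \<longleftrightarrow>
     1 \<le> n \<and> M \<in> carrier_mat n n \<and>
     (\<forall>i\<in>{1..n}. entry M i i = 0) \<and>
     (\<forall>i j. 2 \<le> i \<and> i < j \<and> j \<le> n \<longrightarrow>
        entry M i j = entry M (i - 1) (j - 1) + entry M (i - 1) j) \<and>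
     (\<forall>i\<in>{1..n}. \<forall>j\<in>{1..n}. entry M i j = entry M j i)"

definition doubly_symmetric :: "nat \<Rightarrow> 'a mat \<Rightarrow> bool" where
  "doubly_symmetric n M \<longleftrightarrow>
     M \<in> carrier_mat n n \<and>
     (\<forall>i\<in>{1..n}. \<forall>j\<in>{1..n}.
        entry M i j = entry M j i \<and>
        entry M j i = entry M (n - j + 1) (n - i + 1))"

definition multi_symmetric :: "nat \<Rightarrow> 'a mat \<Rightarrow> bool" where
  "multi_symmetric n M \<longleftrightarrow>
     doubly_symmetric n M \<and>
     (\<forall>i j. 1 \<le> i \<and> i < j \<and> j \<le> n \<longrightarrow> entry M i j = entry M i (n - j + i + 1))"

(* A simple graph is a pair of a vertex set and a set of edges, each edge being a set of two
   distinct vertices. *)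
type_synonym 'v simple_graph = "'v set \<times> 'v set set"

definition vertices :: "'v simple_graph \<Rightarrow> 'v set" where
  "vertices G = fst G"

definition edges :: "'v simple_graph \<Rightarrow> 'v set set" where
  "edges G = snd G"

definition vertex_degree :: "'v simple_graph \<Rightarrow> 'v \<Rightarrow> nat" where
  "vertex_degree G v = card {e \<in> edges G. v \<in> e}"

definition regular_modulo :: "nat \<Rightarrow> 'v simple_graph \<Rightarrow> bool" where
  "regular_modulo m G \<longleftrightarrow>
     (\<forall>u\<in>vertices G. \<forall>v\<in>vertices G. [vertex_degree G u = vertex_degree G v] (mod m))"

(* The vertex V_i is represented by its index i. *)
definition adjacency_graph :: "nat \<Rightarrow> bit mat \<Rightarrow> nat simple_graph" where
  "adjacency_graph n M =
     ({1..n}, {{i, j} | i j. i \<in> {1..n} \<and> j \<in> {1..n} \<and> i \<noteq> j \<and> entry M i j = 1})"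

(* The degree of V_i is the number of ones in row i. *)
lemma vertex_degree_adjacency_graph:
  assumes M: "steinhaus_matrix n M" and i: "i \<in> {1..n}"
  shows "vertex_degree (adjacency_graph n M) i = card {j \<in> {1..n}. entry M i j = 1}"
proof -
  have diag: "entry M k k = 0" if "k \<in> {1..n}" for k
    using M that by (simp add: steinhaus_matrix_def)
  have sym: "entry M k l = entry M l k" if "k \<in> {1..n}" "l \<in> {1..n}" for k l
    using M that unfolding steinhaus_matrix_def by blast
  let ?J = "{j \<in> {1..n}. entry M i j = 1}"
  have ne: "j \<noteq> i" if "j \<in> ?J" for j
    using that diag by auto
  have "{e \<in> edges (adjacency_graph n M). i \<in> e} = (\<lambda>j. {i, j}) ` ?J" (is "?L = ?R")
  proof
    show "?L \<subseteq> ?R"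
    proof
      fix e assume "e \<in> ?L"
      then obtain k l where kl: "e = {k, l}" "k \<in> {1..n}" "l \<in> {1..n}" "entry M k l = 1"
        and "i = k \<or> i = l"
        by (auto simp: edges_def adjacency_graph_def)
      then consider "i = k" | "i = l" by blast
      then show "e \<in> ?R"
      proof cases
        case 1
        then show ?thesis using kl by blast
      next
        case 2
        then have "entry M i k = 1" "e = {i, k}" using kl sym by auto
        then show ?thesis using kl by blast
      qed
    qed
    show "?R \<subseteq> ?L"
      using i ne by (fastforce simp: edges_def adjacency_graph_def)
  qed
  moreover have "inj_on (\<lambda>j. {i, j}) ?J"
    by (auto simp: inj_on_def doubleton_eq_iff)
  ultimately show ?thesis
    by (simp add: vertex_degree_def card_image)
qed

end

theory Submission
  imports Defs
begin

text \<open>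
  In barycentric coordinates the upper triangle of a multi-symmetric Steinhaus matrix of size
  n = 2N + 2 is a linear functional on the homogeneous polynomials of degree 2N in
  F_2[X, Y, Z] / (X + Y + Z) that is invariant under permutations of the variables; the entry
  t x y z is its value at X^x Y^y Z^z. Such a functional is determined by its values on
  Delta^N and on the polynomials X^2 Y E^(2b+1) Delta^(N-3-3b), where Delta = XY + YZ + ZX and
  E = XYZ; write mu_b for the latter values. A row is a palindrome, so its sum is twice a half
  sum, and modulo 2 the half sums telescope. Hence regularity modulo 4 becomes linear: the value
  on Delta^N vanishes and t 1 (2p) (2k+1) = t (p+1) p (2k+1). Expanding both sides of these
  equations in the mu_b and comparing the coefficients of the last mu_b that occurs, one finds that
  mu_b is determined by the preceding ones unless b is congruent to 6 or 7 modulo 8, or b is the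
  largest index.
\<close>

text \<open>These two rules rewrite sums of bits to exclusive ors, which defeats normalization of sums.\<close>

declare add_bit_eq_xor [simp del] mult_bit_eq_and [simp del]

lemma bit_add_self [simp]: "a + a = 0" for a :: bit
  by (cases a) simp_all

lemma bit_add_left_self [simp]: "a + (a + b) = b" for a b :: bit
  by (simp flip: add.assoc)

lemma bit_add_eq_0_iff [simp]: "a + b = 0 \<longleftrightarrow> a = b" for a b :: bit
  by (cases a; cases b) simp_all

section \<open>Counting\<close>

text \<open>The exponent of Delta belonging to b is N - 3 * b - 3. Where it is at most 1 the
  position stays free, because the equations below use up to two factors Delta; for residues 6 and 7
  modulo 8 they give no condition.\<close>

definition free_positions :: "nat \<Rightarrow> nat set" where
  "free_positions N = {b. 3 * b + 3 \<le> N \<and> (N \<le> 3 * b + 4 \<or> 6 \<le> b mod 8)}"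

lemma finite_free_positions: "finite (free_positions N)"
  by (rule finite_subset[of _ "{..N}"]) (auto simp: free_positions_def)

text \<open>\<open>f\<close> leaves two values for each block of eight. A free b with residue below
  6 satisfies N <= 3 * b + 4, so no larger position exists and b cannot collide with residue 6 of
  its block.\<close>

lemma card_free_positions: "card (free_positions N) \<le> (N + 12) div 12"
proof -
  define f where "f b = 2 * (b div 8) + (if b mod 8 = 7 then 1 else 0)" for b :: nat
  have "inj_on f (free_positions N)"
  proof (rule inj_onI)
    fix a b assume *: "a \<in> free_positions N" "b \<in> free_positions N" "f a = f b"
    obtain p r q s where ab: "a = 8 * p + r" "r < 8" "b = 8 * q + s" "s < 8"
      by (metis mult_div_mod_eq mod_less_divisor zero_less_numeral)
    have "2 * p + (if r = 7 then 1 else 0) = 2 * q + (if s = 7 then 1 else (0::nat))"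
      using *(3) ab by (simp add: f_def)
    then have "p = q" "r = 7 \<longleftrightarrow> s = 7"
      by (auto split: if_splits) presburger+
    moreover have "3 * a + 3 \<le> N" "3 * b + 3 \<le> N" "N \<le> 3 * a + 4 \<or> 6 \<le> r" "N \<le> 3 * b + 4 \<or> 6 \<le> s"
      using *(1,2) ab by (simp_all add: free_positions_def)
    ultimately show "a = b"
      using ab by auto
  qed
  moreover have "f ` free_positions N \<subseteq> {..<(N + 12) div 12}"
  proof
    fix x assume "x \<in> f ` free_positions N"
    then obtain b where b: "x = f b" "3 * b + 3 \<le> N" "N \<le> 3 * b + 4 \<or> 6 \<le> b mod 8"
      by (auto simp: free_positions_def)
    obtain p r where ab: "b = 8 * p + r" "r < 8"
      by (metis mult_div_mod_eq mod_less_divisor zero_less_numeral)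
    have "x = 2 * p + (if r = 7 then 1 else 0)"
      using b(1) ab by (simp add: f_def)
    then have "12 * (x + 1) \<le> N + 12"
      using b(2,3) ab by (auto split: if_splits)
    then have "x < (N + 12) div 12"
      by (simp add: less_eq_div_iff_mult_less_eq Suc_le_eq[symmetric])
    then show "x \<in> {..<(N + 12) div 12}" by simp
  qed
  ultimately show ?thesis
    by (metis card_inj_on_le card_lessThan finite_lessThan)
qed

section \<open>Counting ones in bit sequences and palindromes\<close>

definition ones :: "(nat \<Rightarrow> bit) \<Rightarrow> nat \<Rightarrow> nat" where
  "ones f m = card {y. y < m \<and> f y = 1}"

lemma of_nat_ones: "of_nat (ones f m) = (\<Sum>y<m. f y)"
proof -
  have "(\<Sum>y<m. f y) = (\<Sum>y<m. of_bool (f y = 1))"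
    by (intro sum.cong) auto
  also have "\<dots> = of_nat (ones f m)"
    by (simp add: ones_def sum.If_cases of_bool_def lessThan_def Collect_conj_eq)
  finally show ?thesis ..
qed

lemma ones_add: "ones f (m + k) = ones f m + ones (\<lambda>y. f (m + y)) k"
proof -
  have "{y. y < m + k \<and> f y = 1} = {y. y < m \<and> f y = 1} \<union> (+) m ` {y. y < k \<and> f (m + y) = 1}"
  proof (intro equalityI subsetI)
    fix x assume "x \<in> {y. y < m + k \<and> f y = 1}"
    then show "x \<in> {y. y < m \<and> f y = 1} \<union> (+) m ` {y. y < k \<and> f (m + y) = 1}"
      by (cases "x < m") (auto intro!: image_eqI[of _ _ "x - m"])
  qed auto
  moreover have "card ({y. y < m \<and> f y = 1} \<union> (+) m ` {y. y < k \<and> f (m + y) = 1})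
     = card {y. y < m \<and> f y = 1} + card ((+) m ` {y. y < k \<and> f (m + y) = 1})"
    by (intro card_Un_disjoint) auto
  ultimately show ?thesis by (simp add: ones_def card_image)
qed

lemma ones_rev: "ones (\<lambda>y. f (m - 1 - y)) m = ones f m"
  unfolding ones_def by (rule bij_betw_same_card[of "\<lambda>y. m - 1 - y"])
    (auto intro!: bij_betw_byWitness[where f' = "\<lambda>y. m - 1 - y"])

lemma ones_cong: "(\<And>y. y < m \<Longrightarrow> f y = g y) \<Longrightarrow> ones f m = ones g m"
  unfolding ones_def by (metis (no_types, lifting))

lemma ones_palindrome_even:
  assumes "\<And>y. y < 2 * m \<Longrightarrow> f (2 * m - 1 - y) = f y"
  shows "ones f (2 * m) = 2 * ones f m"
proof -
  have "ones (\<lambda>y. f (m + y)) m = ones (\<lambda>y. f (m + (m - 1 - y))) m"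
    by (rule ones_rev[symmetric])
  also have "\<dots> = ones f m"
    using assms by (intro ones_cong) (simp add: mult_2 add.commute)
  finally show ?thesis using ones_add[of f m m] by (simp add: mult_2)
qed

lemma ones_palindrome_odd:
  assumes "\<And>y. y < 2 * m + 1 \<Longrightarrow> f (2 * m - y) = f y"
  shows "ones f (2 * m + 1) = 2 * ones f m + of_bool (f m = 1)"
proof -
  have "ones (\<lambda>y. f (m + 1 + y)) m = ones (\<lambda>y. f (m + 1 + (m - 1 - y))) m"
    by (rule ones_rev[symmetric])
  also have "\<dots> = ones f m"
  proof (rule ones_cong)
    fix y assume "y < m"
    then have "m + 1 + (m - 1 - y) = 2 * m - y" by simp
    then show "f (m + 1 + (m - 1 - y)) = f y" using assms[of y] \<open>y < m\<close> by (simp only:)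
  qed
  finally have "ones (\<lambda>y. f (m + 1 + y)) m = ones f m" .
  moreover have "ones (\<lambda>y. f (m + y)) 1 = of_bool (f m = 1)"
    by (cases "f m") (simp_all add: ones_def cong: conj_cong)
  ultimately show ?thesis using ones_add[of f m 1] ones_add[of f "m + 1" m] by (simp add: mult_2 add_ac)
qed

section \<open>Symmetric Steinhaus triangles\<close>

text \<open>Multiplication by Delta = XY + YZ + ZX, acting on functionals.\<close>

definition delta :: "(nat \<Rightarrow> nat \<Rightarrow> nat \<Rightarrow> bit) \<Rightarrow> nat \<Rightarrow> nat \<Rightarrow> nat \<Rightarrow> bit" where
  "delta t x y z = t (Suc x) (Suc y) z + t x (Suc y) (Suc z) + t (Suc x) y (Suc z)"

text \<open>The rule \<open>steinhaus\<close> says that the functional t kills all multiples of X +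
  Y + Z. The two transpositions generate all permutations of the variables.\<close>

locale symmetric_triangle =
  fixes t :: "nat \<Rightarrow> nat \<Rightarrow> nat \<Rightarrow> bit"
  assumes sym12: "t x y z = t y x z"
    and sym23: "t x y z = t x z y"
    and steinhaus: "t (Suc x) y z + t x (Suc y) z + t x y (Suc z) = 0"
begin

lemma sym13: "t x y z = t z y x"
  by (metis sym12 sym23)

lemma step1: "t (Suc x) y z = t x (Suc y) z + t x y (Suc z)"
  using steinhaus[of x y z] by (metis add.assoc bit_add_eq_0_iff)

lemma step2: "t x (Suc y) z = t (Suc x) y z + t x y (Suc z)"
  by (metis step1 sym12)

lemma step3: "t x y (Suc z) = t (Suc x) y z + t x (Suc y) z"
  by (simp add: step1[of x y z] add_ac)

lemma zero_100: "t (Suc x) y y = 0"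
  by (metis step1 sym23 bit_add_eq_0_iff)

text \<open>Modulo X + Y + Z one has Delta = XY + Z(X + Y) = XY + Z^2.\<close>

lemma delta_eq: "delta t x y z = t (Suc x) (Suc y) z + t x y (Suc (Suc z))"
  unfolding delta_def using step3[of x y "Suc z"] by (metis add.assoc add.commute)

section \<open>Row sums: regularity modulo 4 becomes linear\<close>

context
  fixes N :: nat and r h :: "nat \<Rightarrow> nat"
  defines "r x \<equiv> ones (\<lambda>y. t x y (2 * N - x - y)) (2 * N + 1 - x)"
    and "h x \<equiv> ones (\<lambda>y. t x y (2 * N - x - y)) ((2 * N + 1 - x) div 2)"
  assumes N: "0 < N"
    and support: "\<And>x y z. x + y + z \<noteq> 2 * N \<Longrightarrow> t x y z = 0"
    and regular_mod_4: "\<And>x. x \<le> 2 * N + 1 \<Longrightarrow> [r x + r (2 * N + 1 - x) = r 0] (mod 4)"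
begin

lemma row_odd:
  assumes "odd x" "x \<le> 2 * N"
  shows "r x = 2 * h x"
proof -
  have "\<exists>m. 2 * N + 1 = x + 2 * m" using assms by presburger
  then obtain m where m: "2 * N + 1 = x + 2 * m" ..
  have "ones (\<lambda>y. t x y (2 * N - x - y)) (2 * m) = 2 * ones (\<lambda>y. t x y (2 * N - x - y)) m"
  proof (rule ones_palindrome_even)
    fix y assume "y < 2 * m"
    then have "2 * N - x - (2 * m - 1 - y) = y" "2 * N - x - y = 2 * m - 1 - y" using m by linarith+
    then show "t x (2 * m - 1 - y) (2 * N - x - (2 * m - 1 - y)) = t x y (2 * N - x - y)"
      using sym23 by simp
  qed
  then show ?thesis using m by (simp add: r_def h_def)
qed

lemma row_even:
  assumes "2 * N = x + 2 * m"
  shows "r x = 2 * h x + of_bool (t x m m = 1)"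
proof -
  have "ones (\<lambda>y. t x y (2 * N - x - y)) (2 * m + 1)
      = 2 * ones (\<lambda>y. t x y (2 * N - x - y)) m + of_bool (t x m (2 * N - x - m) = 1)"
  proof (rule ones_palindrome_odd)
    fix y assume "y < 2 * m + 1"
    then have "2 * N - x - (2 * m - y) = y" "2 * N - x - y = 2 * m - y" using assms by linarith+
    then show "t x (2 * m - y) (2 * N - x - (2 * m - y)) = t x y (2 * N - x - y)"
      using sym23 by simp
  qed
  then show ?thesis using assms by (simp add: r_def h_def)
qed

lemma row_pos:
  assumes "0 < x" "x \<le> 2 * N"
  shows "r x = 2 * h x"
proof (cases "odd x")
  case False
  then have "\<exists>m. 2 * N = x + 2 * m" using assms by presburger
  then obtain m where m: "2 * N = x + 2 * m" ..
  then show ?thesis using row_even[OF m] zero_100[of "x - 1" m] assms by simp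
qed (use row_odd assms in simp)

text \<open>Here \<open>r x + r (2 * N + 1 - x)\<close> stands for the degree of V_(x+1). For x = 1
  both summands are even by \<open>row_pos\<close>, so \<open>r 0\<close> is even, and its parity is
  the middle entry.\<close>

lemma middle_first_row: "t 0 N N = 0"
proof -
  have "[r 1 + r (2 * N) = r 0] (mod 4)" using regular_mod_4[of 1] N by simp
  then have "(2 * h 1 + 2 * h (2 * N)) mod 4 = r 0 mod 4"
    using row_pos[of 1] row_pos[of "2 * N"] N by (simp add: cong_def)
  then have "even (r 0)" by presburger
  then show ?thesis using row_even[of 0 N] by (cases "t 0 N N") simp_all
qed

lemma half_rows:
  assumes "0 < x" "x \<le> 2 * N"
  shows "of_nat (h x) + of_nat (h (2 * N + 1 - x)) = (of_nat (h 0) :: bit)"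
proof -
  have "[2 * h x + 2 * h (2 * N + 1 - x) = 2 * h 0] (mod 4)"
    using regular_mod_4[of x] row_pos[of x] row_pos[of "2 * N + 1 - x"] row_even[of 0 N]
      middle_first_row assms by simp
  then have "even (h x + h (2 * N + 1 - x)) = even (h 0)"
    unfolding cong_def by presburger
  then have "(of_nat (h x + h (2 * N + 1 - x)) :: bit) = of_nat (h 0)"
    by (simp only: Z2.bit_eq_iff even_of_nat)
  then show ?thesis by simp
qed

text \<open>Entries of row x + 1 are sums of neighbours in row x, so the sum telescopes to the two
  ends.\<close>

lemma sum_row: "2 * N = x + Suc j + z \<Longrightarrow>
  (\<Sum>y<Suc j. t (Suc x) y (2 * N - Suc x - y)) = t x 0 (2 * N - x) + t x (Suc j) z"
proof (induction j arbitrary: z)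
  case 0
  then show ?case using step1[of x 0 z] by (simp add: add.commute)
next
  case (Suc j)
  then show ?case using Suc.IH[of "Suc z"] step1[of x "Suc j" z] by (simp add: add.assoc)
qed

lemma half_row:
  assumes "2 * N = x + y + z" "0 < y" "z = y \<or> z = Suc y"
  shows "of_nat (h (Suc x)) = t x 0 (2 * N - x) + t x y z"
proof -
  obtain j where j: "y = Suc j"
    using assms(2) gr0_implies_Suc by blast
  have "(2 * N + 1 - Suc x) div 2 = Suc j" using assms j by auto
  then show ?thesis unfolding h_def of_nat_ones using sum_row[of x j z] assms(1) j by simp
qed

lemma middle_zero: "t j j 0 = 0"
proof (cases "j = N")
  case True
  then show ?thesis using middle_first_row sym13[of N N 0] by simp
qed (simp add: support)

lemma middle_zero': "t x m m = 0"
proof (cases x)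
  case 0
  then show ?thesis using middle_zero[of m] sym13[of m m 0] by simp
qed (simp add: zero_100)

text \<open>The two indices add up to 2 * N + 1, so \<open>half_rows\<close> applies to this sum.
  \<open>step2\<close> merges the two border entries coming from \<open>half_row\<close>.\<close>

lemma half_rows_eq:
  assumes "N = p + k + 1"
  shows "of_nat (h (2 * k + 2)) + of_nat (h (2 * p + 1)) = t (2 * k + 1) 1 (2 * p) + t (2 * k + 1) p (p + 1)"
proof -
  have 1: "of_nat (h (2 * k + 2)) = t (2 * k + 1) 0 (2 * p + 1) + t (2 * k + 1) p (p + 1)"
  \<comment> \<open>For p = 0 the half row is empty and the two terms on the right coincide.\<close>
  proof (cases "p = 0")
    case True
    then show ?thesis using assms by (simp add: h_def ones_def)
  next
    case False
    then show ?thesis using half_row[of "2 * k + 1" p "p + 1"] assms by simp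
  qed
  have "of_nat (h (2 * p + 1)) = t (2 * p) 0 (2 * k + 2) + t (2 * p) (k + 1) (k + 1)"
    using half_row[of "2 * p" "k + 1" "k + 1"] assms by simp
  also have "\<dots> = t (2 * k + 2) 0 (2 * p)"
    using middle_zero'[of "2 * p" "k + 1"] sym13 by simp
  finally show ?thesis
    using 1 step2[of "2 * k + 1" 0 "2 * p"] by (simp add: add_ac)
qed

lemma half_first_row: "of_nat (h 0) = (0 :: bit)"
proof -
  obtain k where k: "N = k + 1"
    using N by (metis Suc_eq_plus1 gr0_implies_Suc)
  have "of_nat (h 0) = t (2 * k + 1) 1 0 + t (2 * k + 1) 0 1"
    using half_rows_eq[of 0 k] half_rows[of 1] by (simp add: k add.commute)
  then show ?thesis using sym23 by simp
qed

text \<open>Since \<open>h 0\<close> is even, the two half rows of \<open>half_rows_eq\<close> have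
  equal parity. For all other p and k both values are 0 by \<open>support\<close>.\<close>

lemma central_column: "t 1 (2 * p) (2 * k + 1) = t (p + 1) p (2 * k + 1)"
proof (cases "N = p + k + 1")
  case True
  then have "t (2 * k + 1) 1 (2 * p) = t (2 * k + 1) p (p + 1)"
    using half_rows_eq[OF True] half_rows[of "2 * p + 1"] half_first_row by (simp add: add.commute)
  then show ?thesis using sym13 sym23 by metis
qed (simp add: support)

end

end

text \<open>Requiring \<open>middle\<close> for every j lets the condition pass from t to
  \<open>delta t\<close>, whose degree is lower by two.\<close>

locale centred_triangle = symmetric_triangle +
  assumes middle: "t j j 0 = 0"
begin

lemma zero_000: "t x x x = 0"
proof (cases x)
  case (Suc c)
  have "t (Suc c) (Suc c) (Suc c) = t (Suc (Suc c)) (Suc c) c + t (Suc c) (Suc (Suc c)) c"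
    by (rule step3)
  then show ?thesis using Suc sym12 by (metis bit_add_eq_0_iff)
qed (simp add: middle)

lemma centred_triangle_delta: "centred_triangle (delta t)"
proof
  show "delta t x y z = delta t y x z" for x y z
    unfolding delta_def sym12[of "Suc x" "Suc y" z] sym12[of x "Suc y" "Suc z"] sym12[of "Suc x" y "Suc z"]
    by (simp add: ac_simps)
  show "delta t x y z = delta t x z y" for x y z
    unfolding delta_def sym23[of "Suc x" "Suc y" z] sym23[of x "Suc y" "Suc z"] sym23[of "Suc x" y "Suc z"]
    by (simp add: ac_simps)
  show "delta t (Suc x) y z + delta t x (Suc y) z + delta t x y (Suc z) = 0" for x y z
    using steinhaus[of "Suc x" "Suc y" z] steinhaus[of x y "Suc (Suc z)"]
    by (simp add: delta_eq add_ac)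
  show "delta t j j 0 = 0" for j
    unfolding delta_def using sym12[of "Suc j" j] by (simp add: middle)
qed

text \<open>The three terms of \<open>delta t x x x\<close> are permutations of one value, and three
  copies of a bit sum to that bit.\<close>

lemma zero_110: "t (Suc x) (Suc x) x = 0"
proof -
  have "delta t x x x = 0"
    by (rule centred_triangle.zero_000[OF centred_triangle_delta])
  moreover have "t x (Suc x) (Suc x) = t (Suc x) (Suc x) x" "t (Suc x) x (Suc x) = t (Suc x) (Suc x) x"
    using sym13 sym23 by metis+
  ultimately show ?thesis by (simp add: delta_def)
qed

lemma zero_200: "t (Suc (Suc x)) x x = 0"
  using step1[of "Suc x" x x] sym23[of "Suc x" x "Suc x"] by simp

text \<open>In E^x X^2 Y Delta the other two terms are killed by \<open>zero_110\<close> and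
  \<open>zero_200\<close>.\<close>

lemma delta_210: "delta t (x + 2) (x + 1) x = t (x + 3) (x + 2) x"
  using zero_110[of "Suc x"] zero_200[of "Suc x"]
  by (simp add: delta_def numeral_eq_Suc)

text \<open>Z^3 = Delta Z + E.\<close>
lemma cube: "t x y (z + 3) = delta t x y (z + 1) + t (x + 1) (y + 1) (z + 1)"
  by (simp add: delta_eq numeral_eq_Suc add_ac)

text \<open>(XY)^3 = Delta (XY)^2 + E^2.\<close>
lemma cube_prod: "t (x + 3) (y + 3) z = delta t (x + 2) (y + 2) z + t (x + 2) (y + 2) (z + 2)"
  by (simp add: delta_eq numeral_eq_Suc add_ac)

text \<open>Modulo Delta one has Z^3 = E and Z^2 = XY, so only the monomials E^c X^2 Y remain.\<close>

lemma vanishes_of_delta: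
  assumes d: "\<And>x y z. delta t x y z = 0"
    and \<mu>: "\<And>b. t (2 * b + 3) (2 * b + 2) (2 * b + 1) = 0"
    and even: "\<And>x y z. odd (x + y + z) \<Longrightarrow> t x y z = 0"
  shows "t x y z = 0"
proof -
  have sq: "t x y (z + 2) = t (x + 1) (y + 1) z" for x y z
    using d[of x y z] by (simp add: delta_eq numeral_eq_Suc)
  have cu: "t c (y + 3) z = t (c + 1) (y + 1) (z + 1)" for c y z
    using sq[of c z "y + 1"] by (simp add: sym23 numeral_eq_Suc)
  \<comment> \<open>The power E^c is split off; a cube of a remaining variable is absorbed into it,
    until both exponents are below 3.\<close>
  have A: "t c (y + c) (z + c) = 0" for c y z
  proof (induction "y + z" arbitrary: c y z rule: less_induct)
    case less
    consider "y \<ge> 3" | "z \<ge> 3" | "y < 3" "z < 3" by linarith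
    then show ?case
    proof cases
      case 1
      then obtain y' where y: "y = y' + 3" by (metis le_add_diff_inverse2)
      have "t c (y + c) (z + c) = t (c + 1) (y' + (c + 1)) (z + (c + 1))"
        using cu[of c "y' + c" "z + c"] by (simp add: y add_ac)
      then show ?thesis using less[of y' z "c + 1"] y by simp
    next
      case 2
      then obtain y' where y: "z = y' + 3" by (metis le_add_diff_inverse2)
      have "t c (y + c) (z + c) = t (c + 1) (y' + (c + 1)) (y + (c + 1))"
        using cu[of c "y' + c" "y + c"] by (simp add: y add_ac sym23)
      then show ?thesis using less[of y' y "c + 1"] y by simp
    next
      case 3
      have c00: "t c c c = 0" by (rule zero_000)
      have c10: "t c (c + 1) c = 0" "t c c (c + 1) = 0"
        using zero_100[of c c] sym12 sym13 by (metis Suc_eq_plus1)+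
      have c20: "t c (c + 2) c = 0" "t c c (c + 2) = 0"
        using zero_200[of c] sym12 sym13 by (metis add_2_eq_Suc')+
      have c11: "t c (c + 1) (c + 1) = 0"
        using zero_110[of c] sym13 by (metis Suc_eq_plus1)
      \<comment> \<open>Y^2 Z^2 = X Y^3 = E X, and E^(c+1) X is killed by
        \<open>zero_100\<close>.\<close>
      have c22: "t c (c + 2) (c + 2) = 0"
        using sq[of c "c + 2" c] cu[of c c "c + 1"] zero_100[of "c + 1" "c + 1"]
          sym13[of "c + 1" "c + 3" c] sym13[of "c + 1" "c + 1" "c + 2"]
        by (simp add: numeral_eq_Suc)
      \<comment> \<open>For even c the total degree 3 * c + 3 is odd.\<close>
      have c21: "t (c + 2) (c + 1) c = 0"
      proof (cases "odd c")
        case True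
        then obtain b where "c = 2 * b + 1" by (rule oddE)
        then show ?thesis using \<mu>[of b] by (simp add: numeral_eq_Suc)
      qed (rule even, simp)
      then have c21': "t c (c + 2) (c + 1) = 0" "t c (c + 1) (c + 2) = 0"
        using sym13 sym12 sym23 by metis+
      have "y \<in> {0, 1, 2}" "z \<in> {0, 1, 2}" using 3 by auto
      then show ?thesis using c00 c10 c20 c11 c22 c21' by (auto simp: add_ac)
    qed
  qed
  have B: "t x y z = 0" if "x \<le> y" "x \<le> z" for x y z
    using A[of x "y - x" "z - x"] that by simp
  consider "x \<le> y" "x \<le> z" | "y \<le> x" "y \<le> z" | "z \<le> x" "z \<le> y" by linarith
  then show ?thesis using B sym12 sym13 by cases metis+
qed

lemma centred_triangle_iterate: "centred_triangle ((delta ^^ k) t)"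
proof (induction k)
  case 0
  show ?case by simp unfold_locales
next
  case (Suc k)
  then show ?case by (simp add: centred_triangle.centred_triangle_delta)
qed

end

section \<open>Triangles of regular graphs\<close>

locale regular_triangle = centred_triangle +
  fixes N :: nat
  assumes support: "x + y + z \<noteq> 2 * N \<Longrightarrow> t x y z = 0"
    and regular: "t 1 (2 * p) (2 * k + 1) = t (p + 1) p (2 * k + 1)"
begin

text \<open>\<open>T k\<close> is the functional sending f to t (Delta^k f).\<close>

definition T :: "nat \<Rightarrow> nat \<Rightarrow> nat \<Rightarrow> nat \<Rightarrow> bit" where
  "T k = (delta ^^ k) t"

lemma T_0 [simp]: "T 0 = t"
  by (simp add: T_def)

lemma T_Suc [simp]: "T (Suc k) = delta (T k)"
  by (simp add: T_def)

sublocale T: centred_triangle "T k" for k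
  unfolding T_def by (rule centred_triangle_iterate)

lemma T_support: "x + y + z + 2 * k \<noteq> 2 * N \<Longrightarrow> T k x y z = 0"
  by (induction k arbitrary: x y z) (simp_all add: support delta_def)

text \<open>Since X^2 = Y^2 + Z^2 and Delta = XY + Z^2, regularity turns factors X^2 into factors Delta.\<close>

lemma odd_square: "t (2 * k + 1) (2 * p) (2 * l + 1) = T k (p + 1) p (2 * l + 1)"
proof (induction k arbitrary: p l)
  case 0
  show ?case using regular[of p l] by simp
next
  case (Suc k)
  have "t (2 * Suc k + 1) (2 * p) (2 * l + 1)
      = t (2 * k + 1) (2 * Suc p) (2 * l + 1) + t (2 * k + 1) (2 * p) (2 * Suc l + 1)"
    by (simp add: step1 add_ac)
  also have "\<dots> = T k (Suc p + 1) (Suc p) (2 * l + 1) + T k (p + 1) p (2 * Suc l + 1)"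
    by (simp only: Suc.IH)
  also have "\<dots> = T (Suc k) (p + 1) p (2 * l + 1)"
    by (simp add: T.delta_eq)
  finally show ?case .
qed

lemma odd_square': "t (2 * k + 1) (2 * p) (2 * l + 1) = T l (p + 1) p (2 * k + 1)"
  using odd_square[of l p k] sym13 by simp

text \<open>\<open>t 1 (4 * q) (2 * k + 1)\<close> is evaluated twice: Z^(2k) is traded for Delta^k
  either at once or after one use of \<open>regular\<close>. \<open>regular_odd\<close> starts from
  4 * q + 2 in the same way.\<close>

lemma regular_even: "T k (2 * q + 1) (2 * q) 1 = T k (q + 1) q (2 * q + 1)"
proof -
  have "T k (2 * q + 1) (2 * q) 1 = t (2 * 0 + 1) (2 * (2 * q)) (2 * k + 1)"
    unfolding odd_square' by simp
  also have "\<dots> = t (2 * q + 1) (2 * q) (2 * k + 1)"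
    using regular[of "2 * q" k] by simp
  also have "\<dots> = T k (q + 1) q (2 * q + 1)"
    by (rule odd_square')
  finally show ?thesis .
qed

lemma regular_odd: "T k (2 * q + 2) (2 * q + 1) 1 = T k (q + 2) (q + 1) (2 * q + 1)"
proof -
  have "T k (2 * q + 2) (2 * q + 1) 1 = t (2 * 0 + 1) (2 * (2 * q + 1)) (2 * k + 1)"
    unfolding odd_square' by simp
  also have "\<dots> = t (2 * q + 2) (2 * q + 1) (2 * k + 1)"
    using regular[of "2 * q + 1" k] by simp
  also have "\<dots> = t (2 * q + 1) (2 * (q + 1)) (2 * k + 1)"
    using sym12[of "2 * q + 2" "2 * q + 1"] by simp
  also have "\<dots> = T k (q + 2) (q + 1) (2 * q + 1)"
    unfolding odd_square' by simp
  finally show ?thesis .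
qed

text \<open>
  \<open>\<nu> k c i\<close> is the value at E^(2c+1) X (XY)^i Delta^k and \<open>\<upsilon> k c q\<close> the value at
  E^(2c) XZ (XYZ^2)^q Delta^k. The exponent k of Delta is determined by the degree: for all
  other k these values are 0, which makes the recursions below unconditional.
\<close>

definition \<nu> :: "nat \<Rightarrow> nat \<Rightarrow> nat \<Rightarrow> bit" where
  "\<nu> k c i = T k (2 * c + i + 2) (2 * c + i + 1) (2 * c + 1)"

definition \<upsilon> :: "nat \<Rightarrow> nat \<Rightarrow> nat \<Rightarrow> bit" where
  "\<upsilon> k c q = T k (2 * c + q + 1) (2 * c + q) (2 * c + 2 * q + 1)"

abbreviation \<mu> :: "nat \<Rightarrow> nat \<Rightarrow> bit" where
  "\<mu> k b \<equiv> \<nu> k b 1"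

lemma \<nu>_0 [simp]: "\<nu> k c 0 = 0"
  using T.zero_100[of k "2 * c + 1" "2 * c + 1"] by (simp add: \<nu>_def)

lemma \<nu>_2: "\<nu> k c 2 = \<mu> (Suc k) c"
  using T.delta_210[of k "2 * c + 1"] by (simp add: \<nu>_def numeral_eq_Suc)

lemma \<nu>_add_3: "\<nu> k c (i + 3) = \<nu> (Suc k) c (i + 2) + \<nu> k (Suc c) i"
  using T.cube_prod[of k "2 * c + i + 2" "2 * c + i + 1" "2 * c + 1"]
  by (simp add: \<nu>_def numeral_eq_Suc)

lemma \<upsilon>_0 [simp]: "\<upsilon> k c 0 = 0"
  using T.zero_110[of k "2 * c"] T.sym23[of k "2 * c + 1"] by (simp add: \<upsilon>_def)

lemma \<upsilon>_1: "\<upsilon> k c 1 = \<mu> k c"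
  using T.sym13[of k "2 * c + 2" "2 * c + 1"] T.sym23[of k "2 * c + 3"]
  by (simp add: \<nu>_def \<upsilon>_def numeral_eq_Suc)

text \<open>Z^3 = Delta Z + E splits the monomial into Delta E^(2c+2) XZ and E^(2c+3) X, which
  vanish by \<open>zero_110\<close> and \<open>zero_100\<close>.\<close>

lemma \<upsilon>_2 [simp]: "\<upsilon> k c 2 = 0"
  using T.cube[of k "2 * c + 3" "2 * c + 2" "2 * c + 2"] T.zero_110[of "Suc k" "2 * c + 2"]
    T.sym23[of "Suc k" "2 * c + 3" "2 * c + 2"] T.zero_100[of k "2 * c + 3" "2 * c + 3"]
  by (simp add: \<upsilon>_def numeral_eq_Suc)

text \<open>For w = XYZ^2 = EZ one has w^3 = E^2 Delta w + E^4.\<close>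
lemma \<upsilon>_add_3: "\<upsilon> k c (q + 3) = \<upsilon> (Suc k) (Suc c) (q + 1) + \<upsilon> k (c + 2) q"
  using T.cube[of k "2 * c + q + 4" "2 * c + q + 3" "2 * c + 2 * q + 4"]
  by (simp add: \<upsilon>_def numeral_eq_Suc)

text \<open>The regularity equations now link the two families, so each side can be expanded by its
  own recursion.\<close>

lemma regular_\<nu>_odd: "\<nu> k 0 (2 * q + 1) = \<upsilon> k 0 (q + 1)"
  using regular_even[of k "q + 1"] by (simp add: \<nu>_def \<upsilon>_def)

lemma regular_\<nu>_even: "\<nu> k 0 (2 * q + 2) = \<upsilon> k 1 q"
  using regular_odd[of k "q + 1"] by (simp add: \<nu>_def \<upsilon>_def)

section \<open>Comparing the coefficients of the last \<open>\<mu>\<close>\<close>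

context
  fixes b :: nat
  assumes below: "\<And>c k. c < b \<Longrightarrow> \<mu> k c = 0"
begin

text \<open>
  In the following lemmas only the last \<open>\<mu>\<close> of an expansion survives; its coefficients are
  1, d + 1 and (d + 2) choose 2, reduced modulo 2.
\<close>

lemma \<nu>_low: "c \<le> b \<Longrightarrow> i + 3 * c \<le> 3 * b \<Longrightarrow> \<nu> k c i = 0"
proof (induction i arbitrary: k c rule: less_induct)
  case (less i)
  consider "i = 0" | "i = 1" | "i = 2" | j where "i = j + 3"
    using that(4)[of "i - 3"] by linarith
  then show ?case
  proof cases
    case 4
    then show ?thesis
      using less.IH[of "j + 2" c] less.IH[of j "Suc c"] less.prems by (simp add: \<nu>_add_3)
  qed (use less.prems below in \<open>auto simp: \<nu>_2\<close>)
qed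

lemma \<nu>_1: "c + d = b \<Longrightarrow> \<nu> k c (3 * d + 1) = \<mu> k b"
proof (induction d arbitrary: c)
  case (Suc d)
  have "\<nu> k c (3 * Suc d + 1) = \<nu> (Suc k) c (3 * Suc d) + \<nu> k (Suc c) (3 * d + 1)"
    using \<nu>_add_3[of k c "3 * d + 1"] by (simp add: numeral_eq_Suc)
  then show ?case
    using Suc.prems Suc.IH[of "Suc c"] \<nu>_low[of c "3 * Suc d" "Suc k"] by simp
qed simp

lemma \<nu>_2': "c + d = b \<Longrightarrow> \<nu> k c (3 * d + 2) = (if even d then \<mu> (Suc k) b else 0)"
proof (induction d arbitrary: c)
  case (Suc d)
  have "\<nu> k c (3 * Suc d + 2) = \<nu> (Suc k) c (3 * Suc d + 1) + \<nu> k (Suc c) (3 * d + 2)"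
    using \<nu>_add_3[of k c "3 * d + 2"] by (simp add: numeral_eq_Suc)
  then show ?case
    using Suc.prems Suc.IH[of "Suc c"] \<nu>_1[of c "Suc d" "Suc k"] by simp
qed (use \<nu>_2 in \<open>simp add: numeral_2_eq_2\<close>)

text \<open>The recursion sums the coefficients from \<open>\<nu>_2'\<close>, which alternate 1, 0;
  modulo 2 the partial sums repeat 1, 1, 0, 0.\<close>

lemma \<nu>_3: "c + d = b \<Longrightarrow> \<nu> k c (3 * d + 3) = (if d mod 4 < 2 then \<mu> (Suc (Suc k)) b else 0)"
proof (induction d arbitrary: c)
  case 0
  have "\<nu> k c 3 = \<nu> (Suc k) c 2"
    using \<nu>_add_3[of k c 0] by (simp add: numeral_eq_Suc)
  then show ?case using 0 by (simp add: \<nu>_2)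
next
  case (Suc d)
  have "Suc d mod 4 < 2 \<longleftrightarrow> (even (Suc d) \<longleftrightarrow> \<not> d mod 4 < 2)" by presburger
  moreover have "\<nu> k c (3 * Suc d + 3) = \<nu> (Suc k) c (3 * Suc d + 2) + \<nu> k (Suc c) (3 * d + 3)"
    using \<nu>_add_3[of k c "3 * d + 3"] by (simp add: numeral_eq_Suc)
  ultimately show ?case
    using Suc.prems Suc.IH[of "Suc c"] \<nu>_2'[of c "Suc d" "Suc k"] by auto
qed

text \<open>Give (c, q) the weight 2 * q + 3 * c. In \<open>\<upsilon>_add_3\<close> the Delta term
  lowers it by one and the other term keeps it, while \<open>\<mu> k c\<close> has weight 3 * c + 2.
  The next three lemmas treat the weights 3 * b + 2, 3 * b + 3 and 3 * b + 4.\<close>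

lemma \<upsilon>_low: "c \<le> b \<Longrightarrow> 2 * q + 3 * c \<le> 3 * b + 1 \<Longrightarrow> \<upsilon> k c q = 0"
proof (induction q arbitrary: k c rule: less_induct)
  case (less q)
  consider "q = 0" | "q = 1" | "q = 2" | j where "q = j + 3"
    using that(4)[of "q - 3"] by linarith
  then show ?case
  proof cases
    case 2
    then show ?thesis using less.prems below[of c] by (simp add: \<upsilon>_1 del: One_nat_def)
  next
    case 4
    then show ?thesis
      using less.IH[of "j + 1" "Suc c"] less.IH[of j "c + 2"] less.prems by (simp add: \<upsilon>_add_3)
  qed simp_all
qed

lemma \<upsilon>_1': "c + 2 * j = b \<Longrightarrow> \<upsilon> k c (3 * j + 1) = \<mu> k b"
proof (induction j arbitrary: c)
  case 0
  then show ?case using \<upsilon>_1 by simp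
next
  case (Suc j)
  have "\<upsilon> k c (3 * Suc j + 1) = \<upsilon> (Suc k) (Suc c) (3 * j + 2) + \<upsilon> k (c + 2) (3 * j + 1)"
    using \<upsilon>_add_3[of k c "3 * j + 1"] by (simp add: numeral_eq_Suc)
  then show ?case
    using Suc.prems Suc.IH[of "c + 2"] \<upsilon>_low[of "Suc c" "3 * j + 2" "Suc k"] by simp
qed

lemma \<upsilon>_3: "c + 2 * j + 1 = b \<Longrightarrow> \<upsilon> k c (3 * j + 3) = (if even j then \<mu> (Suc k) b else 0)"
proof (induction j arbitrary: c)
  case 0
  then show ?case using \<upsilon>_add_3[of k c 0] \<upsilon>_1[of "Suc k" "Suc c"] by simp
next
  case (Suc j)
  have "\<upsilon> k c (3 * Suc j + 3) = \<upsilon> (Suc k) (Suc c) (3 * Suc j + 1) + \<upsilon> k (c + 2) (3 * j + 3)"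
    using \<upsilon>_add_3[of k c "3 * j + 3"] by (simp add: numeral_eq_Suc)
  then show ?case
    using Suc.prems Suc.IH[of "c + 2"] \<upsilon>_1'[of "Suc c" "Suc j" "Suc k"] by simp
qed

lemma \<upsilon>_5: "c + 2 * j + 2 = b \<Longrightarrow>
  \<upsilon> k c (3 * j + 5) = (if j mod 4 < 2 then \<mu> (Suc (Suc k)) b else 0)"
proof (induction j arbitrary: c)
  case 0
  have "\<upsilon> k c 5 = \<upsilon> (Suc k) (Suc c) 3"
    using \<upsilon>_add_3[of k c 2] by (simp add: numeral_eq_Suc) (simp flip: numeral_2_eq_2)
  then show ?case using 0 \<upsilon>_3[of "Suc c" 0 "Suc k"] by simp
next
  case (Suc j)
  have "Suc j mod 4 < 2 \<longleftrightarrow> (even (Suc j) \<longleftrightarrow> \<not> j mod 4 < 2)"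
    by presburger
  moreover have "\<upsilon> k c (3 * Suc j + 5) = \<upsilon> (Suc k) (Suc c) (3 * Suc j + 3) + \<upsilon> k (c + 2) (3 * j + 5)"
    using \<upsilon>_add_3[of k c "3 * j + 5"] by (simp add: numeral_eq_Suc)
  ultimately show ?case
    using Suc.prems Suc.IH[of "c + 2"] \<upsilon>_3[of "Suc c" "Suc j" "Suc k"] by auto
qed

text \<open>In the equation with index 3 * b + 2 exactly one side has coefficient 1: the left one
  for b = 4 * i, the right one for b = 4 * i + 1.\<close>

lemma \<mu>_zero_01:
  assumes "b mod 4 < 2"
  shows "\<mu> (Suc k) b = 0"
proof (cases "even b")
  case True
  then have "\<exists>i. b = 4 * i"
    using assms by presburger
  then obtain i where b: "b = 4 * i" ..
  have "\<nu> k 0 (3 * b + 2) = \<upsilon> k 1 (6 * i)"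
    using regular_\<nu>_even[of k "6 * i"] by (simp add: b)
  moreover have "\<upsilon> k 1 (6 * i) = 0"
  proof (cases i)
    case (Suc m)
    then show ?thesis using \<upsilon>_3[of 1 "2 * m + 1" k] by (simp add: b algebra_simps)
  qed simp
  ultimately show ?thesis using \<nu>_2'[of 0 b k] True by simp
next
  case False
  then have "\<exists>i. b = 4 * i + 1"
    using assms by presburger
  then obtain i where b: "b = 4 * i + 1" ..
  have "\<nu> k 0 (3 * b + 2) = \<upsilon> k 0 (3 * (2 * i) + 3)"
  proof -
    have "3 * b + 2 = 2 * (6 * i + 2) + 1" "3 * (2 * i) + 3 = 6 * i + 2 + 1"
      by (simp_all add: b)
    then show ?thesis by (simp only: regular_\<nu>_odd)
  qed
  then show ?thesis using \<nu>_2'[of 0 b k] \<upsilon>_3[of 0 "2 * i" k] b by simp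
qed

text \<open>In the equation with index 3 * b + 3 the left coefficient is 0 and the right one is 1.
  For residues 6 and 7 modulo 8 both would be 0.\<close>

lemma \<mu>_zero_23:
  assumes "b mod 8 = 2 \<or> b mod 8 = 3"
  shows "\<mu> (Suc (Suc k)) b = 0"
proof (cases "even b")
  case True
  then have "\<exists>i. b = 8 * i + 2"
    using assms by presburger
  then obtain i where b: "b = 8 * i + 2" ..
  have "b mod 4 = 2" using b by presburger
  have "\<nu> k 0 (3 * b + 3) = \<upsilon> k 0 (3 * (4 * i) + 5)"
    using regular_\<nu>_odd[of k "12 * i + 4"] by (simp add: b add.commute)
  then show ?thesis using \<nu>_3[of 0 b k] \<upsilon>_5[of 0 "4 * i" k] \<open>b mod 4 = 2\<close> by (simp add: b)
next
  case False
  then have "\<exists>i. b = 8 * i + 3"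
    using assms by presburger
  then obtain i where b: "b = 8 * i + 3" ..
  have "b mod 4 = 3" using b by presburger
  have "\<nu> k 0 (3 * b + 3) = \<upsilon> k 1 (3 * (4 * i) + 5)"
    using regular_\<nu>_even[of k "12 * i + 5"] by (simp add: b)
  then show ?thesis using \<nu>_3[of 0 b k] \<upsilon>_5[of 1 "4 * i" k] \<open>b mod 4 = 3\<close> by (simp add: b)
qed

end

lemma \<mu>_support: "N \<noteq> 3 * b + k + 3 \<Longrightarrow> \<mu> k b = 0"
  unfolding \<nu>_def by (rule T_support) simp

lemma \<mu>_zero:
  assumes "\<And>b. b \<in> free_positions N \<Longrightarrow> \<mu> (N - 3 * b - 3) b = 0"
  shows "\<mu> k b = 0"
proof (induction b arbitrary: k rule: less_induct)
  case (less b)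
  show ?case
  proof (cases "N = 3 * b + k + 3 \<and> b \<notin> free_positions N")
    case True
    \<comment> \<open>A position that is not free has N >= 3 * b + 5, which leaves the two factors
      Delta that \<open>\<mu>_zero_23\<close> needs.\<close>
    then have "2 \<le> k" "b mod 8 < 6" by (auto simp: free_positions_def)
    then obtain k' where k: "k = Suc (Suc k')"
      by (metis One_nat_def Suc_le_D Suc_le_mono numeral_2_eq_2)
    have "b mod 4 < 2 \<or> b mod 8 = 2 \<or> b mod 8 = 3"
      using \<open>b mod 8 < 6\<close> by presburger
    then consider "b mod 4 < 2" | "b mod 8 = 2 \<or> b mod 8 = 3"
      by blast
    then show ?thesis
      using \<mu>_zero_01 \<mu>_zero_23 less.IH by cases (simp_all add: k)
  next
    case False
    then show ?thesis using assms[of b] \<mu>_support[of b k] by (cases "N = 3 * b + k + 3") auto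
  qed
qed

text \<open>Downward induction on k: \<open>T N\<close> lives in degree 0, where it vanishes because
  it is centred, and \<open>vanishes_of_delta\<close> passes from \<open>T (Suc k)\<close> to
  \<open>T k\<close>.\<close>

lemma vanishes:
  assumes "\<And>b. b \<in> free_positions N \<Longrightarrow> \<mu> (N - 3 * b - 3) b = 0"
  shows "t x y z = 0"
proof -
  have \<mu>: "T k (2 * b + 3) (2 * b + 2) (2 * b + 1) = 0" for k b
    using \<mu>_zero[OF assms, of k b] by (simp add: \<nu>_def numeral_eq_Suc)
  have "T k x y z = 0" for k x y z
  proof (cases "k \<le> N")
    case True
    then show ?thesis
    proof (induction k arbitrary: x y z rule: inc_induct)
      case base
      show ?case using T_support[of x y z N] T.zero_000[of N 0]
        by (cases "x + y + z = 0") auto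
    next
      case (step k)
      show ?case
      proof (rule T.vanishes_of_delta)
        show "delta (T k) x y z = 0" for x y z using step.IH by simp
        show "T k x y z = 0" if "odd (x + y + z)" for x y z
          using that by (intro T_support) presburger
      qed (rule \<mu>)
    qed
  next
    case False
    then show ?thesis by (intro T_support) simp
  qed
  from this[of 0] show ?thesis by simp
qed

end

lemma delta_iterate_add:
  "(delta ^^ k) (\<lambda>x y z. s x y z + t x y z) = (\<lambda>x y z. (delta ^^ k) s x y z + (delta ^^ k) t x y z)"
  by (induction k) (auto simp: delta_def fun_eq_iff ac_simps)

text \<open>Linearity reduces equality of two triangles to the vanishing of their sum, which is also
  their difference.\<close>

lemma regular_triangle_add:
  assumes "regular_triangle s N" "regular_triangle t N"
  shows "regular_triangle (\<lambda>x y z. s x y z + t x y z) N"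
proof -
  interpret s: regular_triangle s N by fact
  interpret t: regular_triangle t N by fact
  show ?thesis
  proof
    show "s x y z + t x y z = s y x z + t y x z" for x y z
      using s.sym12 t.sym12 by metis
    show "s x y z + t x y z = s x z y + t x z y" for x y z
      using s.sym23 t.sym23 by metis
    show "s (Suc x) y z + t (Suc x) y z + (s x (Suc y) z + t x (Suc y) z) + (s x y (Suc z) + t x y (Suc z)) = 0"
      for x y z
      by (simp add: s.step1 t.step1 ac_simps)
    show "s j j 0 + t j j 0 = 0" for j
      by (simp add: s.middle t.middle)
    show "s x y z + t x y z = 0" if "x + y + z \<noteq> 2 * N" for x y z
      using that by (simp add: s.support t.support)
    show "s 1 (2 * p) (2 * k + 1) + t 1 (2 * p) (2 * k + 1)
        = s (p + 1) p (2 * k + 1) + t (p + 1) p (2 * k + 1)" for p k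
      by (simp only: s.regular t.regular)
  qed
qed

text \<open>This is \<open>\<mu> (N - 3 * b - 3) b\<close>, written so that it applies to any
  function t.\<close>

definition parameter :: "nat \<Rightarrow> (nat \<Rightarrow> nat \<Rightarrow> nat \<Rightarrow> bit) \<Rightarrow> nat \<Rightarrow> bit" where
  "parameter N t b = (delta ^^ (N - 3 * b - 3)) t (2 * b + 3) (2 * b + 2) (2 * b + 1)"

lemma regular_triangle_eqI:
  assumes "regular_triangle s N" "regular_triangle t N"
    and "\<And>b. b \<in> free_positions N \<Longrightarrow> parameter N s b = parameter N t b"
  shows "s = t"
proof -
  let ?u = "\<lambda>x y z. s x y z + t x y z"
  interpret u: regular_triangle ?u N
    using assms(1,2) by (rule regular_triangle_add)
  have "u.\<mu> (N - 3 * b - 3) b = 0" if "b \<in> free_positions N" for b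
    using assms(3)[OF that]
    by (simp add: u.\<nu>_def u.T_def delta_iterate_add parameter_def numeral_eq_Suc)
  then have "?u x y z = 0" for x y z
    by (rule u.vanishes)
  then show ?thesis by (simp add: fun_eq_iff)
qed

section \<open>From matrices to triangles\<close>

text \<open>The coordinates are the distances of an entry to the top row, the diagonal and the last
  column. Extension by 0 makes the Steinhaus rule hold in every degree.\<close>

definition triangle :: "nat \<Rightarrow> bit mat \<Rightarrow> nat \<Rightarrow> nat \<Rightarrow> nat \<Rightarrow> bit" where
  "triangle n M x y z = (if x + y + z + 2 = n then entry M (x + 1) (x + y + 2) else 0)"

lemma entry_triangle:
  assumes "1 \<le> i" "i < j" "j \<le> n"
  shows "entry M i j = triangle n M (i - 1) (j - i - 1) (n - j)"
proof -
  have "i - 1 + (j - i - 1) + (n - j) + 2 = n" "i - 1 + 1 = i" "i - 1 + (j - i - 1) + 2 = j"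
    using assms by linarith+
  then show ?thesis by (simp only: triangle_def simp_thms if_True)
qed

text \<open>Double symmetry exchanges x and z, the further condition of multi-symmetry exchanges y
  and z, and together these generate all permutations.\<close>

lemma symmetric_triangle_triangle:
  assumes st: "steinhaus_matrix n M" and ms: "multi_symmetric n M"
  shows "symmetric_triangle (triangle n M)"
proof -
  have double: "entry M i j = entry M (n - j + 1) (n - i + 1)" if "i \<in> {1..n}" "j \<in> {1..n}" for i j
    using ms that unfolding multi_symmetric_def doubly_symmetric_def by metis
  have s13: "triangle n M x y z = triangle n M z y x" for x y z
  proof (cases "x + y + z + 2 = n")
    case True
    then have "n - (x + y + 2) + 1 = z + 1" "n - (x + 1) + 1 = z + y + 2" "z + y + x + 2 = n" by linarith+
    then show ?thesis using True double[of "x + 1" "x + y + 2"] by (simp add: triangle_def)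
  qed (simp add: triangle_def)
  have multi: "entry M i j = entry M i (n - j + i + 1)" if "1 \<le> i" "i < j" "j \<le> n" for i j
    using ms that unfolding multi_symmetric_def by blast
  have s23: "triangle n M x y z = triangle n M x z y" for x y z
  proof (cases "x + y + z + 2 = n")
    case True
    then have "n - (x + y + 2) + (x + 1) + 1 = x + z + 2" "x + z + y + 2 = n" by linarith+
    then show ?thesis using True multi[of "x + 1" "x + y + 2"] by (simp add: triangle_def)
  qed (simp add: triangle_def)
  show ?thesis
  proof
    show "triangle n M x y z = triangle n M y x z" for x y z
      using s13 s23 by metis
    show "triangle n M x y z = triangle n M x z y" for x y z
      by (rule s23)
    show "triangle n M (Suc x) y z + triangle n M x (Suc y) z + triangle n M x y (Suc z) = 0" for x y z
    proof (cases "x + y + z + 3 = n")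
      case True
      have "entry M i j = entry M (i - 1) (j - 1) + entry M (i - 1) j" if "2 \<le> i" "i < j" "j \<le> n" for i j
        using st that unfolding steinhaus_matrix_def by blast
      from this[of "x + 2" "x + y + 3"] show ?thesis
        using True by (auto simp: triangle_def numeral_eq_Suc add_ac)
    qed (simp add: triangle_def)
  qed
qed

text \<open>The diagonal splits a matrix row. Its right part is row x of the triangle; its left part
  is a column, which the symmetries turn into row n - 1 - x.\<close>

lemma vertex_degree_triangle:
  assumes st: "steinhaus_matrix n M" and ms: "multi_symmetric n M" and x: "x < n"
  defines "r k \<equiv> ones (\<lambda>y. triangle n M k y (n - 2 - k - y)) (n - 1 - k)"
  shows "vertex_degree (adjacency_graph n M) (x + 1) = r x + r (n - 1 - x)"
proof -
  interpret symmetric_triangle "triangle n M"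
    using st ms by (rule symmetric_triangle_triangle)
  have sym: "entry M i j = entry M j i" if "i \<in> {1..n}" "j \<in> {1..n}" for i j
    using st that unfolding steinhaus_matrix_def by blast
  define f where "f y = entry M (x + 1) (y + 1)" for y
  have "bij_betw Suc {y. y < n \<and> f y = 1} {j \<in> {1..n}. entry M (x + 1) j = 1}"
    by (rule bij_betw_byWitness[where f' = "\<lambda>j. j - 1"]) (auto simp: f_def Suc_le_eq)
  then have "card {j \<in> {1..n}. entry M (x + 1) j = 1} = ones f n"
    unfolding ones_def by (rule bij_betw_same_card[symmetric])
  moreover have "ones f (x + (1 + (n - 1 - x)))
      = ones f x + (ones (\<lambda>y. f (x + y)) 1 + ones (\<lambda>y. f (x + (1 + y))) (n - 1 - x))"
    by (simp only: ones_add)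
  moreover have "x + (1 + (n - 1 - x)) = n" using x by simp
  moreover have "ones (\<lambda>y. f (x + y)) 1 = 0"
  proof -
    have "entry M (x + 1) (x + 1) = 0" using st x by (simp add: steinhaus_matrix_def)
    then show ?thesis by (simp add: ones_def f_def cong: conj_cong)
  qed
  moreover have "ones f x = r (n - 1 - x)"
  proof -
    have "ones f x = ones (\<lambda>y. triangle n M (n - 1 - x) y (n - 2 - (n - 1 - x) - y)) x"
    proof (rule ones_cong)
      fix y assume "y < x"
      then have "f y = entry M (y + 1) (x + 1)" using sym[of "x + 1" "y + 1"] x by (simp add: f_def)
      also have "\<dots> = triangle n M y (x - 1 - y) (n - 1 - x)"
        using \<open>y < x\<close> x entry_triangle[of "y + 1" "x + 1" n M] by simp
      also have "\<dots> = triangle n M (n - 1 - x) y (x - 1 - y)" using sym12 sym13 by metis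
      also have "x - 1 - y = n - 2 - (n - 1 - x) - y" using \<open>y < x\<close> x by simp
      finally show "f y = triangle n M (n - 1 - x) y (n - 2 - (n - 1 - x) - y)" .
    qed
    then show ?thesis using x by (simp add: r_def)
  qed
  moreover have "ones (\<lambda>y. f (x + (1 + y))) (n - 1 - x) = r x"
    unfolding r_def
  proof (rule ones_cong)
    fix y assume "y < n - 1 - x"
    then show "f (x + (1 + y)) = triangle n M x y (n - 2 - x - y)"
      by (simp add: f_def triangle_def)
  qed
  ultimately show ?thesis
    using vertex_degree_adjacency_graph[OF st, of "x + 1"] x by simp
qed

lemma regular_triangle_triangle:
  assumes st: "steinhaus_matrix n M" and ms: "multi_symmetric n M"
    and reg: "regular_modulo 4 (adjacency_graph n M)" and n: "n = 2 * N + 2" and N: "0 < N"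
  shows "regular_triangle (triangle n M) N"
proof -
  interpret symmetric_triangle "triangle n M"
    using st ms by (rule symmetric_triangle_triangle)
  define r where "r k = ones (\<lambda>y. triangle n M k y (2 * N - k - y)) (2 * N + 1 - k)" for k
  have support: "triangle n M x y z = 0" if "x + y + z \<noteq> 2 * N" for x y z
    using that n by (simp add: triangle_def)
  have deg: "vertex_degree (adjacency_graph n M) (x + 1) = r x + r (2 * N + 1 - x)" if "x \<le> 2 * N + 1" for x
    using vertex_degree_triangle[OF st ms, of x] that n by (simp add: r_def)
  have "[r x + r (2 * N + 1 - x) = r 0] (mod 4)" if "x \<le> 2 * N + 1" for x
  proof -
    \<comment> \<open>The last row is empty, so \<open>r 0\<close> alone is the degree of
      V_1.\<close>
    have "r (2 * N + 1) = 0" by (simp add: r_def ones_def)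
    moreover have "[vertex_degree (adjacency_graph n M) (x + 1) = vertex_degree (adjacency_graph n M) (0 + 1)] (mod 4)"
      using reg that n unfolding regular_modulo_def by (simp add: vertices_def adjacency_graph_def)
    ultimately show ?thesis using deg[OF that] deg[of 0] by simp
  qed
  note facts = N support this[unfolded r_def]
  show ?thesis
  proof
    show "triangle n M j j 0 = 0" for j using facts by (rule middle_zero)
    show "triangle n M 1 (2 * p) (2 * k + 1) = triangle n M (p + 1) p (2 * k + 1)" for p k
      using facts by (rule central_column)
  qed (rule support)
qed

lemma matrix_eqI:
  assumes "steinhaus_matrix n M" "steinhaus_matrix n M'" "triangle n M = triangle n M'"
  shows "M = M'"
proof (rule eq_matI)
  have dim: "dim_row M = n" "dim_col M = n" "dim_row M' = n" "dim_col M' = n"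
    using assms by (auto simp: steinhaus_matrix_def)
  show "dim_row M = dim_row M'" "dim_col M = dim_col M'"
    by (simp_all add: dim)
  fix i j assume "i < dim_row M'" "j < dim_col M'"
  then have ij: "i + 1 \<in> {1..n}" "j + 1 \<in> {1..n}" by (simp_all add: dim)
  have less: "entry M i j = entry M' i j" if "1 \<le> i" "i < j" "j \<le> n" for i j
    using assms(3) that by (simp add: entry_triangle)
  have sym: "entry M i j = entry M j i" "entry M' i j = entry M' j i" if "i \<in> {1..n}" "j \<in> {1..n}" for i j
    using assms(1,2) that unfolding steinhaus_matrix_def by blast+
  have diag: "entry M i i = 0" "entry M' i i = 0" if "i \<in> {1..n}" for i
    using assms(1,2) that unfolding steinhaus_matrix_def by blast+
  have "entry M (i + 1) (j + 1) = entry M' (i + 1) (j + 1)"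
    using less[of "i + 1" "j + 1"] less[of "j + 1" "i + 1"] sym[OF ij] diag[of "i + 1"] ij
    by (cases i j rule: linorder_cases) auto
  then show "M $$ (i, j) = M' $$ (i, j)"
    by (simp add: entry_def)
qed

theorem theorem7:
  fixes n :: nat
  assumes "even n" and "n > 0"
  shows "finite {M. steinhaus_matrix n M \<and> multi_symmetric n M \<and>
                    regular_modulo 4 (adjacency_graph n M)} \<and>
         card {M. steinhaus_matrix n M \<and> multi_symmetric n M \<and>
                  regular_modulo 4 (adjacency_graph n M)}
           \<le> 2 ^ nat \<lceil>real n / 24\<rceil>"
proof -
  let ?S = "{M. steinhaus_matrix n M \<and> multi_symmetric n M \<and> regular_modulo 4 (adjacency_graph n M)}"
  have "\<exists>N. n = 2 * N + 2" using assms by presburger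
  then obtain N where n: "n = 2 * N + 2" ..
  show ?thesis
  \<comment> \<open>For n = 2 the single entry above the diagonal may be 1, so the middle value need
    not vanish; this case is counted directly.\<close>
  proof (cases "N = 0")
    case True
    have inj: "inj_on (\<lambda>M. triangle n M 0 0 0) ?S"
    proof (rule inj_onI)
      fix M M' assume "M \<in> ?S" "M' \<in> ?S" "triangle n M 0 0 0 = triangle n M' 0 0 0"
      moreover from this have "triangle n M = triangle n M'"
        using n True by (auto simp: triangle_def fun_eq_iff)
      ultimately show "M = M'" using matrix_eqI by blast
    qed
    have img: "(\<lambda>M. triangle n M 0 0 0) ` ?S \<subseteq> {0, 1}"
      using bit_not_zero_iff by blast
    have "\<lceil>real n / 24\<rceil> = 1"
      using n True by (intro ceiling_unique) simp_all
    then show ?thesis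
      using inj_on_finite[OF inj img] card_inj_on_le[OF inj img] by simp
  next
    case False
    define \<Phi> where "\<Phi> M = {b \<in> free_positions N. parameter N (triangle n M) b = 1}" for M
    have "inj_on \<Phi> ?S"
    proof (rule inj_onI)
      fix M M' assume *: "M \<in> ?S" "M' \<in> ?S" "\<Phi> M = \<Phi> M'"
      have "triangle n M = triangle n M'"
      proof (rule regular_triangle_eqI)
        show "regular_triangle (triangle n M) N" "regular_triangle (triangle n M') N"
          using * regular_triangle_triangle n False by auto
        fix b assume "b \<in> free_positions N"
        then have "parameter N (triangle n M) b = 1 \<longleftrightarrow> parameter N (triangle n M') b = 1"
          using *(3) unfolding \<Phi>_def by blast
        then show "parameter N (triangle n M) b = parameter N (triangle n M') b"
          using bit_not_one_iff by metis
      qed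
      then show "M = M'" using * matrix_eqI by blast
    qed
    moreover have "\<Phi> ` ?S \<subseteq> Pow (free_positions N)" by (auto simp: \<Phi>_def)
    moreover have fin: "finite (Pow (free_positions N))" by (simp add: finite_free_positions)
    ultimately have "finite ?S" "card ?S \<le> card (Pow (free_positions N))"
      by (rule inj_on_finite, rule card_inj_on_le)
    moreover have "card (Pow (free_positions N)) \<le> 2 ^ nat \<lceil>real n / 24\<rceil>"
    proof -
      \<comment> \<open>The quotient minus 1 is at most N / 12 = (n - 2) / 24, which is less than n
        / 24.\<close>
      have "12 * ((N + 12) div 12) \<le> N + 12" by simp
      then have "12 * real ((N + 12) div 12) \<le> real N + 12"
        by (metis of_nat_add of_nat_le_iff of_nat_mult of_nat_numeral)
      then have "real ((N + 12) div 12) - 1 < real n / 24"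
        using n by (simp add: field_simps)
      then have "(N + 12) div 12 \<le> nat \<lceil>real n / 24\<rceil>"
        by linarith
      then show ?thesis
        using card_free_positions[of N] by (simp add: card_Pow finite_free_positions)
    qed
    ultimately show ?thesis by linarith
  qed
qed

end
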